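(* Let $A\in\mathbb{R}^{m\times n}$. Then for all $b\in A(\mathbb{R}^n)+\mathbb{R}^m_+$ and all $u\in\mathbb{R}^n$, $$\operatorname{dist}(u,P_A(b))\le H(A)\cdot \operatorname{dist}(b-Au,\mathbb{R}^m_+)\le H(A)\cdot\|(Au-b)_+\|.$$ Furthermore, the first bound is tight: if $H(A)>0$ then there exist $b\in A(\mathbb{R}^n)+\mathbb{R}^m_+$ and $u\in\mathbb{R}^n$ such that $$\operatorname{dist}(u,P_A(b))=H(A)\cdot\operatorname{dist}(b-Au,\mathbb{R}^m_+)>0.$$
   Context: $\mathbb{R}^n$ and $\mathbb{R}^m$ are each endowed with an arbitrary norm (not necessarily Euclidean), both denoted $\|\cdot\|$. For a nonempty closed set $S$, $\operatorname{dist}(u,S)=\min_{x\in S}\|u-x\|$. $P_A(b):=\{x\in\mathbb{R}^n: Ax\le b\}$ (componentwise inequality). $A(\mathbb{R}^n)=\{Ax:x\in\mathbb{R}^n\}$ and $A(\mathbb{R}^n)+\mathbb{R}^m_+$ is the Minkowski sum. $(Au-b)_+:=\max(0,Au-b)$ componentwise. $[m]=\{1,\dots,m\}$. For $J\subseteq[m]$, $A_J$ is the submatrix of $A$ of rows indexed by $J$, $y_J$ the corresponding subvector of $y\in\mathbb{R}^m$. Define $\mathcal{S}(A):=\{J\subseteq[m]: A_J(\mathbb{R}^n)+\mathbb{R}^J_+=\mathbb{R}^J\}$ (with $\emptyset\in\mathcal S(A)$), and for $J\in\mathcal{S}(A)$ $$H_J(A):=\max_{y\in\mathbb{R}^m,\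 \|y\|\le 1}\ \min_{x\in\mathbb{R}^n,\ A_Jx\le y_J}\|x\|,$$ with $H_J(A):=0$ if $J=\emptyset$. Define $H(A):=\max_{J\in\mathcal{S}(A)}H_J(A)$. *)

theory Defs
  imports "HOL-Analysis.Analysis"
begin

definition is_norm :: "('a::real_vector \<Rightarrow> real) \<Rightarrow> bool" where
  "is_norm N \<longleftrightarrow>
     (\<forall>x. 0 \<le> N x) \<and>
     (\<forall>x. N x = 0 \<longleftrightarrow> x = 0) \<and>
     (\<forall>c x. N (c *\<^sub>R x) = \<bar>c\<bar> * N x) \<and>
     (\<forall>x y. N (x + y) \<le> N x + N y)"

text \<open>Minima and maxima over sets of reals are rendered by \<open>LEAST\<close> and \<open>GREATEST\<close>
  rather than by \<open>Inf\<close> and \<open>Sup\<close>: they are specified only when the extremum is attained.\<close>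

definition dist_to :: "('a::real_vector \<Rightarrow> real) \<Rightarrow> 'a \<Rightarrow> 'a set \<Rightarrow> real" where
  "dist_to N u S = (LEAST r. \<exists>x\<in>S. r = N (u - x))"

definition polyhedron_of :: "real^'n^'m \<Rightarrow> real^'m \<Rightarrow> (real^'n) set" where
  "polyhedron_of A b = {x. A *v x \<le> b}"

definition orthant :: "(real^'m) set" where
  "orthant = {s. 0 \<le> s}"

definition pos_part :: "real^'m \<Rightarrow> real^'m" where
  "pos_part v = (\<chi> i. max 0 (v $ i))"

text \<open>For a set \<open>J\<close> of row indices, the space of real vectors indexed by \<open>J\<close> is
  \<open>J \<rightarrow>\<^sub>E UNIV\<close>, so for \<open>J = {}\<close> it is a singleton.\<close>

definition sub_range :: "real^'n^'m \<Rightarrow> 'm set \<Rightarrow> ('m \<Rightarrow> real) set" where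
  "sub_range A J = range (\<lambda>x. \<lambda>i\<in>J. (A *v x) $ i)"

definition sub_orthant :: "'m set \<Rightarrow> ('m \<Rightarrow> real) set" where
  "sub_orthant J = (J \<rightarrow>\<^sub>E {0..})"

definition surjective_sets :: "real^'n^'m \<Rightarrow> 'm set set" where
  "surjective_sets A =
     {J. {\<lambda>i\<in>J. p i + s i | p s. p \<in> sub_range A J \<and> s \<in> sub_orthant J} = (J \<rightarrow>\<^sub>E UNIV)}"

text \<open>\<open>N\<close> is the norm on the domain and \<open>M\<close> the norm on the codomain of \<open>A\<close>.\<close>

definition hoffman_sub ::
  "(real^'n \<Rightarrow> real) \<Rightarrow> (real^'m \<Rightarrow> real) \<Rightarrow> real^'n^'m \<Rightarrow> 'm set \<Rightarrow> real" where
  "hoffman_sub N M A J =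
     (if J = {} then 0
      else GREATEST h. \<exists>y. M y \<le> 1 \<and>
             h = (LEAST r. \<exists>x. (\<forall>i\<in>J. (A *v x) $ i \<le> y $ i) \<and> r = N x))"

definition hoffman ::
  "(real^'n \<Rightarrow> real) \<Rightarrow> (real^'m \<Rightarrow> real) \<Rightarrow> real^'n^'m \<Rightarrow> real" where
  "hoffman N M A = Max (hoffman_sub N M A ` surjective_sets A)"

end

theory Submission imports Defs begin

text \<open>After translating \<open>u\<close> to \<open>0\<close>, let \<open>z \<noteq> 0\<close> be a point of least norm in \<open>P = {x. A x \<le> c}\<close>.
  A hyperplane with normal \<open>w\<close> separates \<open>P\<close> from the open ball of radius \<open>N z\<close>; it touches both at \<open>z\<close>.
  By Farkas' lemma \<open>w\<close> is a nonnegative combination of the negated rows active at \<open>z\<close>, and by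
  Caratheodory's theorem for cones linearly independent active rows, indexed by \<open>J\<close>, suffice. Hence
  \<open>J\<close> is a surjective set, and \<open>z\<close> has least norm even among the solutions of \<open>A\<^sub>J x \<le> c\<^sub>J\<close>. For
  \<open>y \<le> c\<close> the system \<open>A\<^sub>J x \<le> y\<^sub>J\<close> is more restrictive, so \<open>N z \<le> H\<^sub>J(A) * M y\<close> by homogeneity; take
  \<open>c - y\<close> to be the point of the orthant closest to \<open>c\<close>.

  The bound is attained at \<open>u = 0\<close> when \<open>b\<close> agrees on an optimal \<open>J\<close> with an optimal \<open>y\<close> and is so large
  off \<open>J\<close> that a least-norm solution of \<open>A\<^sub>J x \<le> y\<^sub>J\<close> remains feasible.\<close>

section \<open>Finitely generated cones\<close>

text \<open>For infinite \<open>V\<close> the sum is \<open>0\<close>, so this is the generated cone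
  only when \<open>V\<close> is finite.\<close>

definition finite_cone :: "'a::real_vector set \<Rightarrow> 'a set" where
  "finite_cone V = {\<Sum>v\<in>V. l v *\<^sub>R v | l. \<forall>v\<in>V. 0 \<le> l v}"

lemma finite_coneI:
  "x = (\<Sum>v\<in>V. l v *\<^sub>R v) \<Longrightarrow> (\<And>v. v \<in> V \<Longrightarrow> 0 \<le> l v) \<Longrightarrow> x \<in> finite_cone V"
  unfolding finite_cone_def by blast

lemma finite_coneE:
  assumes "x \<in> finite_cone V"
  obtains l where "x = (\<Sum>v\<in>V. l v *\<^sub>R v)" "\<And>v. v \<in> V \<Longrightarrow> 0 \<le> l v"
  using assms unfolding finite_cone_def by blast

lemma finite_cone_zero: "0 \<in> finite_cone V"
  by (rule finite_coneI[of _ "\<lambda>_. 0"]) auto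

lemma finite_cone_add:
  assumes "x \<in> finite_cone V" "y \<in> finite_cone V"
  shows "x + y \<in> finite_cone V"
proof -
  obtain l where l: "x = (\<Sum>v\<in>V. l v *\<^sub>R v)" "\<And>v. v \<in> V \<Longrightarrow> 0 \<le> l v"
    using assms(1) by (rule finite_coneE) blast
  obtain k where k: "y = (\<Sum>v\<in>V. k v *\<^sub>R v)" "\<And>v. v \<in> V \<Longrightarrow> 0 \<le> k v"
    using assms(2) by (rule finite_coneE) blast
  show ?thesis
    by (rule finite_coneI[of _ "\<lambda>v. l v + k v"]) (auto simp: l k scaleR_left_distrib sum.distrib)
qed

lemma finite_cone_scaleR:
  assumes "x \<in> finite_cone V" "0 \<le> c"
  shows "c *\<^sub>R x \<in> finite_cone V"
proof -
  obtain l where l: "x = (\<Sum>v\<in>V. l v *\<^sub>R v)" "\<And>v. v \<in> V \<Longrightarrow> 0 \<le> l v"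
    using assms(1) by (rule finite_coneE) blast
  show ?thesis
    by (rule finite_coneI[of _ "\<lambda>v. c * l v"]) (auto simp: l assms(2) scaleR_sum_right)
qed

lemma convex_finite_cone: "convex (finite_cone V)"
  by (rule convexI) (intro finite_cone_add finite_cone_scaleR)

lemma finite_cone_mono:
  assumes "finite V" "U \<subseteq> V"
  shows "finite_cone U \<subseteq> finite_cone V"
proof
  fix x assume "x \<in> finite_cone U"
  then obtain l where l: "x = (\<Sum>v\<in>U. l v *\<^sub>R v)" "\<And>v. v \<in> U \<Longrightarrow> 0 \<le> l v"
    by (rule finite_coneE) blast
  have "(\<Sum>v\<in>V. (if v \<in> U then l v else 0) *\<^sub>R v) = x"
    unfolding l by (rule sum.mono_neutral_cong_right) (use assms in auto)
  then show "x \<in> finite_cone V"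
    by (intro finite_coneI[of _ "\<lambda>v. if v \<in> U then l v else 0"]) (use l in auto)
qed

lemma finite_cone_base:
  assumes "finite V" "v \<in> V"
  shows "v \<in> finite_cone V"
proof -
  have "v \<in> finite_cone {v}"
    by (rule finite_coneI[of _ "\<lambda>_. 1"]) auto
  then show ?thesis using finite_cone_mono[of V "{v}"] assms by auto
qed

text \<open>Subtracting a multiple of a linear relation leaves \<open>x\<close> unchanged. The
  largest multiple that keeps all coefficients nonnegative makes one of them vanish.\<close>

lemma finite_cone_drop_dependent:
  assumes "finite V" "dependent V" "x \<in> finite_cone V"
  shows "\<exists>u\<in>V. x \<in> finite_cone (V - {u})"
proof -
  obtain l where l: "x = (\<Sum>v\<in>V. l v *\<^sub>R v)" "\<And>v. v \<in> V \<Longrightarrow> 0 \<le> l v"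
    using assms(3) by (rule finite_coneE) blast
  obtain d w where d: "(\<Sum>v\<in>V. d v *\<^sub>R v) = 0" "w \<in> V" "d w \<noteq> 0"
    using assms(1,2) dependent_finite by blast
  \<comment> \<open>The sign is chosen so that the relation has a positive coefficient; the minimum
    ratio \<open>t\<close> is then taken over a nonempty set.\<close>
  define c where "c = (if d w > 0 then d else (\<lambda>v. - d v))"
  have c: "(\<Sum>v\<in>V. c v *\<^sub>R v) = 0" "c w > 0"
    using d by (auto simp: c_def sum_negf)
  define P where "P = {v \<in> V. c v > 0}"
  define t where "t = Min ((\<lambda>v. l v / c v) ` P)"
  have P: "finite P" "P \<noteq> {}" using assms(1) d c by (auto simp: P_def)
  have "t \<in> (\<lambda>v. l v / c v) ` P"
    unfolding t_def by (rule Min_in) (use P in auto)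
  then obtain u where u: "u \<in> P" "t = l u / c u" by auto
  have t0: "0 \<le> t" using u l by (auto simp: P_def)
  have pos: "0 \<le> l v - t * c v" if "v \<in> V" for v
  proof (cases "c v > 0")
    case True
    then have "t \<le> l v / c v" unfolding t_def by (intro Min_le) (use P that in \<open>auto simp: P_def\<close>)
    then show ?thesis using True by (simp add: field_simps)
  next
    case False
    then have "t * c v \<le> 0" using t0 by (simp add: mult_nonneg_nonpos)
    then show ?thesis using l(2)[OF that] by linarith
  qed
  have uV: "u \<in> V" "l u - t * c u = 0" using u by (auto simp: P_def)
  have "x = (\<Sum>v\<in>V. l v *\<^sub>R v) - t *\<^sub>R (\<Sum>v\<in>V. c v *\<^sub>R v)" using l c by simp
  also have "\<dots> = (\<Sum>v\<in>V. (l v - t * c v) *\<^sub>R v)"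
    by (simp add: scaleR_left_diff_distrib sum_subtractf scaleR_sum_right)
  also have "\<dots> = (\<Sum>v\<in>V - {u}. (l v - t * c v) *\<^sub>R v)"
    using uV by (simp add: sum.remove[OF assms(1) uV(1)])
  finally have "x \<in> finite_cone (V - {u})"
    by (rule finite_coneI) (use pos in auto)
  then show ?thesis using uV by blast
qed

text \<open>Generators are discarded one at a time until the remaining ones are independent.\<close>

lemma finite_cone_caratheodory:
  assumes "finite V" "x \<in> finite_cone V"
  shows "\<exists>U\<subseteq>V. independent U \<and> x \<in> finite_cone U"
  using assms
proof (induction "card V" arbitrary: V rule: less_induct)
  case less
  show ?case
  proof (cases "independent V")
    case True
    then show ?thesis using less.prems by blast
  next
    case False
    then obtain u where u: "u \<in> V" "x \<in> finite_cone (V - {u})"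
      using finite_cone_drop_dependent less.prems by blast
    have "card (V - {u}) < card V" using less.prems(1) u(1) by (rule card_Diff1_less)
    then obtain U where "U \<subseteq> V - {u}" "independent U" "x \<in> finite_cone U"
      using less.hyps u less.prems by (metis finite_Diff)
    then show ?thesis by blast
  qed
qed

text \<open>Independence gives a linear functional with the prescribed values on \<open>U\<close>;
  its adjoint at \<open>1\<close> is the representing vector.\<close>

lemma independent_inner_values:
  fixes U :: "'a::euclidean_space set"
  assumes "independent U"
  shows "\<exists>x. \<forall>v\<in>U. x \<bullet> v = h v"
proof -
  obtain g :: "'a \<Rightarrow> real" where g: "linear g" "\<forall>v\<in>U. g v = h v"
    using linear_independent_extend[OF assms] by blast
  have "adjoint g 1 \<bullet> v = g v" for v
    using adjoint_works[OF g(1), of v 1] by (simp add: inner_commute)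
  then show ?thesis using g(2) by metis
qed

lemma closed_finite_cone_independent:
  fixes U :: "'a::euclidean_space set"
  assumes "independent U"
  shows "closed (finite_cone U)"
proof -
  \<comment> \<open>The vectors \<open>f u\<close> form a dual system to \<open>U\<close>, so they
    read off coefficients.\<close>
  obtain f :: "'a \<Rightarrow> 'a" where f: "\<And>u v. u \<in> U \<Longrightarrow> v \<in> U \<Longrightarrow> f u \<bullet> v = (if u = v then 1 else 0)"
    using independent_inner_values[OF assms, of "\<lambda>v. if u = v then 1 else 0" for u] by metis
  have fin: "finite U" using assms by (rule finiteI_independent)
  have coord: "f u \<bullet> (\<Sum>v\<in>U. l v *\<^sub>R v) = l u" if "u \<in> U" for u l
  proof -
    have "f u \<bullet> (\<Sum>v\<in>U. l v *\<^sub>R v) = (\<Sum>v\<in>U. if u = v then l v else 0)"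
      by (auto simp: inner_sum_right f[OF that] intro!: sum.cong)
    then show ?thesis using fin that by simp
  qed
  \<comment> \<open>Over independent generators the coefficients are restrictions of linear functionals.\<close>
  have "finite_cone U = span U \<inter> (\<Inter>u\<in>U. {x. 0 \<le> f u \<bullet> x})"
  proof (intro equalityI subsetI)
    fix x assume "x \<in> finite_cone U"
    then obtain l where l: "x = (\<Sum>v\<in>U. l v *\<^sub>R v)" "\<And>v. v \<in> U \<Longrightarrow> 0 \<le> l v"
      by (rule finite_coneE) blast
    then show "x \<in> span U \<inter> (\<Inter>u\<in>U. {x. 0 \<le> f u \<bullet> x})"
      by (auto simp: coord intro: span_sum span_scale span_base)
  next
    fix x assume x: "x \<in> span U \<inter> (\<Inter>u\<in>U. {x. 0 \<le> f u \<bullet> x})"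
    then obtain l where l: "x = (\<Sum>v\<in>U. l v *\<^sub>R v)"
      using span_finite[OF fin] by auto
    show "x \<in> finite_cone U"
      by (rule finite_coneI[OF l]) (use x in \<open>auto simp: l coord\<close>)
  qed
  then show ?thesis
    by (auto intro!: closed_Int closed_INT closed_halfspace_ge simp: closed_subspace)
qed

text \<open>By Caratheodory the cone is a finite union of closed cones over independent subsets.
  Closedness is what permits strict separation in \<open>farkas\<close>.\<close>

lemma closed_finite_cone:
  fixes V :: "'a::euclidean_space set"
  assumes "finite V"
  shows "closed (finite_cone V)"
proof -
  have "finite_cone V = \<Union> (finite_cone ` {U. U \<subseteq> V \<and> independent U})"
    using finite_cone_caratheodory[OF assms] finite_cone_mono[OF assms] by blast
  moreover have "finite {U. U \<subseteq> V \<and> independent U}"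
    using assms by (auto intro: finite_subset[of _ "Pow V"])
  ultimately show ?thesis
    by (metis (no_types, lifting) closed_UN closed_finite_cone_independent mem_Collect_eq)
qed

text \<open>If \<open>w\<close> lay outside the closed convex cone, a strictly separating
  \<open>d\<close> would be nonnegative on all generators but negative on \<open>w\<close>.\<close>

lemma farkas:
  fixes V :: "'a::euclidean_space set"
  assumes "finite V" and nonneg: "\<And>d. (\<And>v. v \<in> V \<Longrightarrow> 0 \<le> v \<bullet> d) \<Longrightarrow> 0 \<le> w \<bullet> d"
  shows "w \<in> finite_cone V"
proof (rule ccontr)
  assume "w \<notin> finite_cone V"
  then obtain d b where db: "d \<bullet> w < b" "\<forall>x\<in>finite_cone V. b < d \<bullet> x"
    using separating_hyperplane_closed_point[OF convex_finite_cone closed_finite_cone[OF assms(1)]]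
    by blast
  have b0: "b < 0" using db(2) finite_cone_zero by fastforce
  have "0 \<le> v \<bullet> d" if "v \<in> V" for v
  proof (rule ccontr)
    assume neg: "\<not> 0 \<le> v \<bullet> d"
    \<comment> \<open>This multiple of \<open>v\<close> has inner product exactly \<open>b\<close>
      with \<open>d\<close>, which strict separation forbids.\<close>
    have "(b / (v \<bullet> d)) *\<^sub>R v \<in> finite_cone V"
      using b0 neg by (intro finite_cone_scaleR finite_cone_base assms that) (simp add: divide_nonpos_neg)
    then have "b < d \<bullet> ((b / (v \<bullet> d)) *\<^sub>R v)" using db(2) by blast
    then show False using neg by (simp add: inner_commute)
  qed
  then have "0 \<le> w \<bullet> d" by (rule nonneg)
  then show False using db(1) b0 by (simp add: inner_commute)
qed

section \<open>Arbitrary norms on Euclidean spaces\<close>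

text \<open>The type already carries its Euclidean norm, so an arbitrary norm is modelled as a
  function; the inner product stays available for separation.\<close>

locale norm_fun =
  fixes N :: "'a::euclidean_space \<Rightarrow> real"
  assumes is_norm: "is_norm N"
begin

lemma nonneg: "0 \<le> N x" and eq_0_iff: "N x = 0 \<longleftrightarrow> x = 0"
  and scaleR: "N (c *\<^sub>R x) = \<bar>c\<bar> * N x" and triangle: "N (x + y) \<le> N x + N y"
  using is_norm by (auto simp: is_norm_def)

lemma minus: "N (- x) = N x"
  using scaleR[of "- 1" x] by simp

lemma zero: "N 0 = 0"
  by (simp add: eq_0_iff)

lemma convex_on: "convex_on UNIV N"
proof (rule convex_onI)
  fix t :: real and x y assume "0 < t" "t < 1"
  then show "N ((1 - t) *\<^sub>R x + t *\<^sub>R y) \<le> (1 - t) * N x + t * N y"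
    using triangle[of "(1 - t) *\<^sub>R x" "t *\<^sub>R y"] by (simp add: scaleR)
qed auto

text \<open>Continuity comes from convexity: a finite convex function on an open set in finite
  dimension is continuous.\<close>

lemma continuous: "continuous_on S N"
  using convex_on_continuous[OF open_UNIV convex_on] continuous_on_subset by blast

lemma closed_sublevel: "closed {x. N x \<le> r}"
  by (intro closed_Collect_le continuous continuous_on_const)

text \<open>On the compact Euclidean unit sphere \<open>N\<close> has a positive minimum, and
  homogeneity extends the bound to all \<open>x\<close>. This makes sublevel sets of
  \<open>N\<close> bounded.\<close>

lemma norm_le: "\<exists>k>0. \<forall>x. k * norm x \<le> N x"
proof (cases "sphere (0::'a) 1 = {}")
  case True
  then show ?thesis by simp
next
  case False
  then obtain e where e: "norm e = 1" "\<And>y. norm y = 1 \<Longrightarrow> N e \<le> N y"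
    using continuous_attains_inf[of "sphere 0 1" N] continuous by auto
  have "N e * norm x \<le> N x" for x
  proof (cases "x = 0")
    case True
    then show ?thesis by (simp add: zero)
  next
    case False
    then have "N e \<le> N ((1 / norm x) *\<^sub>R x)" by (intro e) simp
    then show ?thesis using False by (simp add: scaleR field_simps)
  qed
  moreover have "N e > 0" using e(1) nonneg[of e] eq_0_iff[of e] by fastforce
  ultimately show ?thesis by blast
qed

lemma compact_sublevel: "compact {x. N x \<le> r}"
proof -
  obtain k where k: "k > 0" "\<And>x. k * norm x \<le> N x" using norm_le by blast
  have "norm x \<le> r / k" if "N x \<le> r" for x
    using k(1) order_trans[OF k(2) that] by (simp add: field_simps)
  then have "bounded {x. N x \<le> r}" unfolding bounded_iff by blast
  then show ?thesis using closed_sublevel compact_eq_bounded_closed by blast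
qed

text \<open>Cutting \<open>S\<close> with the sublevel set through one of its points gives a compact
  set with the same minimum.\<close>

lemma attains_min:
  assumes "closed S" "S \<noteq> {}"
  obtains z where "z \<in> S" "\<And>x. x \<in> S \<Longrightarrow> N z \<le> N x"
proof -
  obtain s where s: "s \<in> S" using assms by blast
  have "compact (S \<inter> {x. N x \<le> N s})"
    using assms(1) compact_sublevel by (rule closed_Int_compact)
  then obtain z where z: "z \<in> S" "N z \<le> N s" "\<And>x. x \<in> S \<Longrightarrow> N x \<le> N s \<Longrightarrow> N z \<le> N x"
    using continuous_attains_inf[of "S \<inter> {x. N x \<le> N s}" N] continuous s by auto
  then have "N z \<le> N x" if "x \<in> S" for x using that by (cases "N x \<le> N s") auto
  then show ?thesis using z that by blast
qed

text \<open>Passing to the reflected translate \<open>u - S\<close> reduces distance to least norm.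
  Attainment shows that \<open>LEAST\<close> in \<open>dist_to\<close> is a genuine minimum.\<close>

lemma dist_to_attained:
  assumes "closed S" "S \<noteq> {}"
  obtains z where "z \<in> S" "dist_to N u S = N (u - z)" "\<And>x. x \<in> S \<Longrightarrow> N (u - z) \<le> N (u - x)"
proof -
  have "(\<lambda>x. u - x) ` S = (+) u ` uminus ` S" by (simp add: image_image)
  then have "closed ((\<lambda>x. u - x) ` S)" using assms(1) by (simp only: closed_translation closed_negations)
  then obtain w where "w \<in> (\<lambda>x. u - x) ` S" "\<And>x. x \<in> (\<lambda>x. u - x) ` S \<Longrightarrow> N w \<le> N x"
    using attains_min[of "(\<lambda>x. u - x) ` S"] assms(2) by auto
  then obtain z where z: "z \<in> S" "\<And>x. x \<in> S \<Longrightarrow> N (u - z) \<le> N (u - x)" by auto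
  have "dist_to N u S = N (u - z)"
    unfolding dist_to_def by (rule Least_equality) (use z in auto)
  then show ?thesis using z that by blast
qed

lemma dist_to_le:
  assumes "closed S" "x \<in> S"
  shows "dist_to N u S \<le> N (u - x)"
  by (rule dist_to_attained[OF assms(1), of u]) (use assms(2) in auto)

end


section \<open>Surjective sets of rows\<close>

text \<open>The orthant component is the slack \<open>y - A *v x\<close> on \<open>J\<close>, which
  turns surjectivity into solvability for every right-hand side.\<close>

lemma surjective_sets_iff:
  "J \<in> surjective_sets A \<longleftrightarrow> (\<forall>y. \<exists>x. \<forall>i\<in>J. (A *v x) $ i \<le> y $ i)"
proof
  assume J: "J \<in> surjective_sets A"
  show "\<forall>y. \<exists>x. \<forall>i\<in>J. (A *v x) $ i \<le> y $ i"
  proof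
    fix y
    have "(\<lambda>i\<in>J. y $ i) \<in> {\<lambda>i\<in>J. p i + s i | p s. p \<in> sub_range A J \<and> s \<in> sub_orthant J}"
      using J unfolding surjective_sets_def by auto
    then obtain x s where s: "s \<in> sub_orthant J"
      and eq: "(\<lambda>i\<in>J. y $ i) = (\<lambda>i\<in>J. (\<lambda>i\<in>J. (A *v x) $ i) i + s i)"
      unfolding sub_range_def by blast
    have "(A *v x) $ i \<le> y $ i" if "i \<in> J" for i
    proof -
      have "0 \<le> s i" using s that by (auto simp: sub_orthant_def)
      moreover have "y $ i = (A *v x) $ i + s i" using fun_cong[OF eq, of i] that by simp
      ultimately show ?thesis by simp
    qed
    then show "\<exists>x. \<forall>i\<in>J. (A *v x) $ i \<le> y $ i" by blast
  qed
next
  assume R: "\<forall>y. \<exists>x. \<forall>i\<in>J. (A *v x) $ i \<le> y $ i"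
  have "f \<in> {\<lambda>i\<in>J. p i + s i | p s. p \<in> sub_range A J \<and> s \<in> sub_orthant J}"
    if f: "f \<in> J \<rightarrow>\<^sub>E UNIV" for f
  proof -
    obtain x where x: "\<forall>i\<in>J. (A *v x) $ i \<le> (\<chi> i. f i) $ i" using R by blast
    define p where "p = (\<lambda>i\<in>J. (A *v x) $ i)"
    define s where "s = (\<lambda>i\<in>J. f i - (A *v x) $ i)"
    have "p \<in> sub_range A J" by (simp add: p_def sub_range_def)
    moreover have "s \<in> sub_orthant J" using x by (auto simp: s_def sub_orthant_def)
    \<comment> \<open>Outside \<open>J\<close> both sides are \<open>undefined\<close>, because
      \<open>f\<close> is extensional.\<close>
    moreover have "f = (\<lambda>i\<in>J. p i + s i)"
      using f by (auto simp: p_def s_def fun_eq_iff restrict_def PiE_def extensional_def)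
    ultimately show ?thesis by blast
  qed
  then show "J \<in> surjective_sets A" unfolding surjective_sets_def by auto
qed

text \<open>The system is even solved with equality. Injectivity lets the prescribed value depend on
  the row vector instead of its index; the rows are negated to match the cone used with
  \<open>farkas\<close>.\<close>

lemma independent_rows_surjective:
  fixes A :: "real^'n^'m"
  assumes "inj_on (\<lambda>i. - (A $ i)) J" "independent ((\<lambda>i. - (A $ i)) ` J)"
  shows "J \<in> surjective_sets A"
  unfolding surjective_sets_iff
proof
  fix y :: "real^'m"
  obtain x where x: "\<forall>v\<in>(\<lambda>i. - (A $ i)) ` J. x \<bullet> v = - (y $ inv_into J (\<lambda>i. - (A $ i)) v)"
    using independent_inner_values[OF assms(2), of "\<lambda>v. - (y $ inv_into J (\<lambda>i. - (A $ i)) v)"] by blast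
  have "(A *v x) $ i = y $ i" if "i \<in> J" for i
    using bspec[OF x, of "- (A $ i)"] that inv_into_f_f[OF assms(1) that]
    by (simp add: matrix_vector_mul_component inner_commute)
  then show "\<exists>x. \<forall>i\<in>J. (A *v x) $ i \<le> y $ i" by (metis order_refl)
qed

section \<open>Polyhedra, the orthant and feasible directions\<close>

lemma closed_sub_polyhedron:
  fixes A :: "real^'n^'m"
  shows "closed {x. \<forall>i\<in>J. (A *v x) $ i \<le> y $ i}"
proof -
  have "{x. \<forall>i\<in>J. (A *v x) $ i \<le> y $ i} = (\<Inter>i\<in>J. {x. A $ i \<bullet> x \<le> y $ i})"
    by (auto simp: matrix_vector_mul_component)
  then show ?thesis by (auto intro: closed_halfspace_le)
qed

lemma polyhedron_of_eq: "polyhedron_of A b = {x. \<forall>i\<in>UNIV. (A *v x) $ i \<le> b $ i}"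
  by (simp add: polyhedron_of_def less_eq_vec_def)

lemma closed_polyhedron_of: "closed (polyhedron_of A b)"
  unfolding polyhedron_of_eq by (rule closed_sub_polyhedron)

lemma convex_polyhedron_of: "convex (polyhedron_of A b)"
proof -
  have "polyhedron_of A b = (\<Inter>i. {x. A $ i \<bullet> x \<le> b $ i})"
    by (auto simp: polyhedron_of_eq matrix_vector_mul_component)
  then show ?thesis by (auto intro: convex_INT convex_halfspace_le)
qed

lemma closed_orthant: "closed (orthant :: (real^'m) set)"
proof -
  have eq: "orthant = (\<Inter>i. {s :: real^'m. 0 \<le> s $ i})"
    by (auto simp: orthant_def less_eq_vec_def)
  show ?thesis
    unfolding eq by (intro closed_INT ballI closed_Collect_le continuous_intros)
qed

lemma range_plus_orthant_iff:
  "b \<in> range (\<lambda>x. A *v x) + orthant \<longleftrightarrow> polyhedron_of A b \<noteq> {}"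
proof
  assume "b \<in> range (\<lambda>x. A *v x) + orthant"
  then obtain x s where "b = A *v x + s" "0 \<le> s"
    by (auto simp: set_plus_def orthant_def)
  then have "x \<in> polyhedron_of A b" by (simp add: polyhedron_of_def)
  then show "polyhedron_of A b \<noteq> {}" by blast
next
  assume "polyhedron_of A b \<noteq> {}"
  then obtain x where "A *v x \<le> b" by (auto simp: polyhedron_of_def)
  then have "b = A *v x + (b - A *v x)" "b - A *v x \<in> orthant" by (auto simp: orthant_def)
  then show "b \<in> range (\<lambda>x. A *v x) + orthant" by (metis rangeI set_plus_intro)
qed

text \<open>Active constraints do not increase along \<open>d\<close> and inactive ones have slack,
  so each holds for all small \<open>t > 0\<close>; there are only finitely many.\<close>

lemma polyhedron_feasible_direction:
  fixes A :: "real^'n^'m"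
  assumes z: "z \<in> polyhedron_of A c"
    and d: "\<And>i. (A *v z) $ i = c $ i \<Longrightarrow> (A *v d) $ i \<le> 0"
  shows "\<exists>t>0. z + t *\<^sub>R d \<in> polyhedron_of A c"
proof -
  have "\<forall>\<^sub>F t in at_right 0. (A *v z) $ i + t * (A *v d) $ i \<le> c $ i" for i
  proof (cases "(A *v z) $ i = c $ i")
    case True
    have "(A *v z) $ i + t * (A *v d) $ i \<le> c $ i" if "t > 0" for t
      using mult_nonneg_nonpos[of t "(A *v d) $ i"] d[OF True] that True by simp
    then show ?thesis
      by (rule eventually_mono[OF eventually_at_right_less])
  next
    case False
    then have "(A *v z) $ i < c $ i" using z by (simp add: polyhedron_of_eq order_less_le)
    moreover have "((\<lambda>t. (A *v z) $ i + t * (A *v d) $ i) \<longlongrightarrow> (A *v z) $ i + 0 * (A *v d) $ i) (at_right 0)"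
      by (intro tendsto_intros)
    ultimately have "\<forall>\<^sub>F t in at_right 0. (A *v z) $ i + t * (A *v d) $ i < c $ i"
      by (intro order_tendstoD(2)) auto
    then show ?thesis by eventually_elim simp
  qed
  then have "\<forall>\<^sub>F t in at_right 0. \<forall>i. (A *v z) $ i + t * (A *v d) $ i \<le> c $ i"
    by (rule eventually_all_finite)
  then have "\<forall>\<^sub>F t in at_right 0. t > 0 \<and> (\<forall>i. (A *v z) $ i + t * (A *v d) $ i \<le> c $ i)"
    by (rule eventually_conj[OF eventually_at_right_less])
  then obtain t where "t > 0" "\<forall>i. (A *v z) $ i + t * (A *v d) $ i \<le> c $ i"
    using eventually_happens'[OF trivial_limit_at_right_real] by blast
  then show ?thesis
    by (auto simp: polyhedron_of_eq matrix_vector_right_distrib matrix_vector_mult_scaleR)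
qed

section \<open>The local constants\<close>

locale norm_pair = dom: norm_fun N + cod: norm_fun M
  for N :: "real^'n \<Rightarrow> real" and M :: "real^'m \<Rightarrow> real" +
  fixes A :: "real^'n^'m"
begin

text \<open>The inner minimum of \<open>hoffman_sub\<close>, isolated so that it can be studied as a
  function of \<open>y\<close>.\<close>

definition least_norm :: "'m set \<Rightarrow> real^'m \<Rightarrow> real" where
  "least_norm J y = (LEAST r. \<exists>x. (\<forall>i\<in>J. (A *v x) $ i \<le> y $ i) \<and> r = N x)"

lemma hoffman_sub_eq:
  "hoffman_sub N M A J = (if J = {} then 0 else GREATEST h. \<exists>y. M y \<le> 1 \<and> h = least_norm J y)"
  by (simp add: hoffman_sub_def least_norm_def)

lemma least_norm_eq:
  assumes "\<forall>i\<in>J. (A *v z) $ i \<le> y $ i"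
    and "\<And>x. \<forall>i\<in>J. (A *v x) $ i \<le> y $ i \<Longrightarrow> N z \<le> N x"
  shows "least_norm J y = N z"
  unfolding least_norm_def by (rule Least_equality) (use assms in auto)

text \<open>Surjectivity makes the closed feasible set nonempty, so \<open>LEAST\<close> is a
  genuine minimum.\<close>

lemma least_norm_attained:
  assumes "J \<in> surjective_sets A"
  obtains z where "\<forall>i\<in>J. (A *v z) $ i \<le> y $ i" "least_norm J y = N z"
    "\<And>x. \<forall>i\<in>J. (A *v x) $ i \<le> y $ i \<Longrightarrow> N z \<le> N x"
proof -
  have "{x. \<forall>i\<in>J. (A *v x) $ i \<le> y $ i} \<noteq> {}"
    using assms unfolding surjective_sets_iff by blast
  then obtain z where "z \<in> {x. \<forall>i\<in>J. (A *v x) $ i \<le> y $ i}"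
    "\<And>x. x \<in> {x. \<forall>i\<in>J. (A *v x) $ i \<le> y $ i} \<Longrightarrow> N z \<le> N x"
    by (rule dom.attains_min[OF closed_sub_polyhedron]) blast
  then show ?thesis using that least_norm_eq by auto
qed

lemma least_norm_le:
  assumes "J \<in> surjective_sets A" "\<forall>i\<in>J. (A *v x) $ i \<le> y $ i"
  shows "least_norm J y \<le> N x"
  by (rule least_norm_attained[OF assms(1), of y]) (use assms(2) in auto)

text \<open>A convex combination of minimisers for \<open>y\<close> and \<open>y'\<close> is
  feasible for the combined right-hand side.\<close>

lemma convex_on_least_norm:
  assumes J: "J \<in> surjective_sets A"
  shows "convex_on UNIV (least_norm J)"
proof (rule convex_onI)
  fix t :: real and y y' assume t: "0 < t" "t < 1"
  obtain x where x: "\<forall>i\<in>J. (A *v x) $ i \<le> y $ i" "least_norm J y = N x"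
    by (rule least_norm_attained[OF J, of y]) blast
  obtain x' where x': "\<forall>i\<in>J. (A *v x') $ i \<le> y' $ i" "least_norm J y' = N x'"
    by (rule least_norm_attained[OF J, of y']) blast
  have "least_norm J ((1 - t) *\<^sub>R y + t *\<^sub>R y') \<le> N ((1 - t) *\<^sub>R x + t *\<^sub>R x')"
    using x(1) x'(1) t
    by (intro least_norm_le J)
      (auto simp: matrix_vector_right_distrib matrix_vector_mult_scaleR intro!: add_mono mult_left_mono)
  also have "\<dots> \<le> (1 - t) * N x + t * N x'"
    using dom.triangle[of "(1 - t) *\<^sub>R x" "t *\<^sub>R x'"] t by (simp add: dom.scaleR)
  finally show "least_norm J ((1 - t) *\<^sub>R y + t *\<^sub>R y') \<le> (1 - t) * least_norm J y + t * least_norm J y'"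
    by (simp add: x x')
qed auto

text \<open>A finite convex function is continuous, so the maximum in \<open>H\<^sub>J(A)\<close> exists and the \<open>GREATEST\<close> in its
  definition is not a junk value.\<close>

lemma hoffman_sub_attained:
  assumes J: "J \<in> surjective_sets A" "J \<noteq> {}"
  obtains y where "M y \<le> 1" "hoffman_sub N M A J = least_norm J y"
    "\<And>y'. M y' \<le> 1 \<Longrightarrow> least_norm J y' \<le> least_norm J y"
proof -
  have "continuous_on {y. M y \<le> 1} (least_norm J)"
    using convex_on_continuous[OF open_UNIV convex_on_least_norm[OF J(1)]] continuous_on_subset by blast
  moreover have "{y. M y \<le> 1} \<noteq> {}" using cod.zero by (auto intro: exI[of _ 0])
  ultimately obtain y where y: "M y \<le> 1" "\<And>y'. M y' \<le> 1 \<Longrightarrow> least_norm J y' \<le> least_norm J y"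
    using continuous_attains_sup[OF cod.compact_sublevel, of 1 "least_norm J"] by auto
  have "hoffman_sub N M A J = least_norm J y"
    unfolding hoffman_sub_eq using J(2) y by (auto intro!: Greatest_equality)
  then show ?thesis using y that by blast
qed

text \<open>Positive homogeneity: \<open>y\<close> is normalised to \<open>M\<close>-norm one and
  the minimiser is scaled back.\<close>

lemma least_norm_le_hoffman_sub:
  assumes J: "J \<in> surjective_sets A" "J \<noteq> {}"
  shows "least_norm J y \<le> hoffman_sub N M A J * M y"
proof (cases "y = 0")
  case True
  have "least_norm J 0 \<le> N 0" by (rule least_norm_le[OF J(1)]) simp
  then show ?thesis using True by (simp add: dom.zero cod.zero)
next
  case False
  then have M: "M y > 0" using cod.nonneg[of y] cod.eq_0_iff[of y] by simp
  define y' where "y' = (1 / M y) *\<^sub>R y"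
  have My': "M y' \<le> 1" using M by (simp add: y'_def cod.scaleR)
  have le: "least_norm J y' \<le> hoffman_sub N M A J"
    by (rule hoffman_sub_attained[OF J]) (simp add: My')
  obtain x where x: "\<forall>i\<in>J. (A *v x) $ i \<le> y' $ i" "least_norm J y' = N x"
    by (rule least_norm_attained[OF J(1), of y']) blast
  have "least_norm J y \<le> N (M y *\<^sub>R x)"
    using x(1) M by (intro least_norm_le J) (simp add: y'_def matrix_vector_mult_scaleR field_simps)
  also have "\<dots> = M y * least_norm J y'" using M by (simp add: dom.scaleR x)
  also have "\<dots> \<le> M y * hoffman_sub N M A J" using le M by simp
  finally show ?thesis by (simp add: mult.commute)
qed

section \<open>The global constant as a maximum over surjective sets\<close>

lemma hoffman_sub_le_hoffman:
  "J \<in> surjective_sets A \<Longrightarrow> hoffman_sub N M A J \<le> hoffman N M A"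
  unfolding hoffman_def by (intro Max_ge) auto

lemma empty_surjective: "{} \<in> surjective_sets A"
  by (simp add: surjective_sets_iff)

text \<open>The empty set of rows is surjective and contributes \<open>0\<close> to the
  maximum.\<close>

lemma hoffman_nonneg: "0 \<le> hoffman N M A"
  using hoffman_sub_le_hoffman[OF empty_surjective] by (simp add: hoffman_sub_def)

lemma hoffman_attained:
  obtains J where "J \<in> surjective_sets A" "hoffman N M A = hoffman_sub N M A J"
proof -
  have "hoffman N M A \<in> hoffman_sub N M A ` surjective_sets A"
    unfolding hoffman_def using empty_surjective by (intro Max_in) auto
  then show ?thesis using that by blast
qed

section \<open>Optimality conditions for a least-norm point\<close>

text \<open>Strictness on the open ball is the form needed later: its contrapositive turns
  \<open>w \<bullet> z \<le> w \<bullet> x\<close> into \<open>N z \<le> N x\<close>.\<close>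

lemma least_norm_point_separation:
  assumes z: "z \<in> polyhedron_of A c" "z \<noteq> 0"
    and least: "\<And>x. x \<in> polyhedron_of A c \<Longrightarrow> N z \<le> N x"
  obtains w where "w \<noteq> 0" "\<forall>x\<in>polyhedron_of A c. w \<bullet> z \<le> w \<bullet> x"
    "\<forall>x. N x < N z \<longrightarrow> w \<bullet> x < w \<bullet> z"
proof -
  define B where "B = {x. N x < N z}"
  have Nz: "N z > 0" using z(2) dom.nonneg[of z] dom.eq_0_iff[of z] by simp
  have "convex B"
  proof (rule convexI)
    fix x y and u v :: real assume *: "x \<in> B" "y \<in> B" "0 \<le> u" "0 \<le> v" "u + v = 1"
    have "N (u *\<^sub>R x + v *\<^sub>R y) \<le> u * N x + v * N y"
      using dom.triangle[of "u *\<^sub>R x" "v *\<^sub>R y"] * by (simp add: dom.scaleR)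
    also have "\<dots> < N z" using * unfolding B_def by (intro convex_bound_lt) auto
    finally show "u *\<^sub>R x + v *\<^sub>R y \<in> B" by (simp add: B_def)
  qed
  moreover have "0 \<in> B" using Nz by (simp add: B_def dom.zero)
  moreover have "B \<inter> polyhedron_of A c = {}" using least by (fastforce simp: B_def)
  ultimately obtain w b where w: "w \<noteq> 0" "\<forall>x\<in>B. w \<bullet> x \<le> b" "\<forall>x\<in>polyhedron_of A c. b \<le> w \<bullet> x"
    using separating_hyperplane_sets[of B "polyhedron_of A c"] convex_polyhedron_of z(1)
    by (metis empty_iff)
  \<comment> \<open>The points \<open>t *\<^sub>R z\<close> with \<open>0 < t < 1\<close> lie in
    \<open>B\<close>, and \<open>t\<close> tends to \<open>1\<close>.\<close>
  have "w \<bullet> z \<le> b"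
  proof (rule field_le_mult_one_interval)
    fix t :: real assume t: "0 < t" "t < 1"
    then have "t *\<^sub>R z \<in> B" using Nz by (simp add: B_def dom.scaleR)
    then show "t * (w \<bullet> z) \<le> b" using w(2) by fastforce
  qed
  then have wz: "w \<bullet> z = b" using w(3) z(1) by force
  have strict: "w \<bullet> x < b" if x: "N x < N z" for x
  proof -
    \<comment> \<open>A step of this size along \<open>w\<close> uses at most half of the gap
      \<open>N z - N x\<close>, so it stays in \<open>B\<close> while strictly raising the
      functional.\<close>
    define e where "e = (N z - N x) / (2 * N w)"
    have Nw: "N w > 0" using w(1) dom.nonneg[of w] dom.eq_0_iff[of w] by simp
    have e: "e > 0" using x Nw by (simp add: e_def)
    have "N (x + e *\<^sub>R w) \<le> N x + e * N w"
      using dom.triangle[of x "e *\<^sub>R w"] e by (simp add: dom.scaleR)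
    also have "\<dots> < N z" using x Nw by (simp add: e_def field_simps)
    finally have "x + e *\<^sub>R w \<in> B" by (simp add: B_def)
    then have "w \<bullet> x + e * (w \<bullet> w) \<le> b" using w(2) by (fastforce simp: inner_add_right)
    moreover have "e * (w \<bullet> w) > 0" using e w(1) by simp
    ultimately show ?thesis by linarith
  qed
  show ?thesis using that[of w] w wz strict by auto
qed

text \<open>The coefficients of \<open>w\<close> act as Lagrange multipliers: they involve only rows
  in \<open>J\<close>, so \<open>z\<close> stays optimal when the other constraints are
  dropped.\<close>

lemma least_norm_point_surjective_set:
  assumes z: "z \<in> polyhedron_of A c" "z \<noteq> 0"
    and least: "\<And>x. x \<in> polyhedron_of A c \<Longrightarrow> N z \<le> N x"
  obtains J where "J \<in> surjective_sets A" "J \<noteq> {}" "least_norm J c = N z"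
proof -
  obtain w where w: "w \<noteq> 0" "\<forall>x\<in>polyhedron_of A c. w \<bullet> z \<le> w \<bullet> x"
    "\<forall>x. N x < N z \<longrightarrow> w \<bullet> x < w \<bullet> z"
    by (rule least_norm_point_separation[OF assms]) blast
  define I where "I = {i. (A *v z) $ i = c $ i}"
  have "w \<in> finite_cone ((\<lambda>i. - (A $ i)) ` I)"
  proof (rule farkas)
    fix d assume d: "\<And>v. v \<in> (\<lambda>i. - (A $ i)) ` I \<Longrightarrow> 0 \<le> v \<bullet> d"
    have "(A *v d) $ i \<le> 0" if "(A *v z) $ i = c $ i" for i
      using d[of "- (A $ i)"] that by (auto simp: I_def matrix_vector_mul_component)
    then obtain t where t: "t > 0" "z + t *\<^sub>R d \<in> polyhedron_of A c"
      using polyhedron_feasible_direction[OF z(1)] by blast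
    have "0 \<le> t * (w \<bullet> d)" using bspec[OF w(2) t(2)] by (simp add: inner_add_right)
    then show "0 \<le> w \<bullet> d" using t(1) by (simp add: zero_le_mult_iff)
  qed simp
  then obtain U where U: "U \<subseteq> (\<lambda>i. - (A $ i)) ` I" "independent U" "w \<in> finite_cone U"
    using finite_cone_caratheodory by (metis finite finite_imageI)
  then obtain J where J: "J \<subseteq> I" "inj_on (\<lambda>i. - (A $ i)) J" "U = (\<lambda>i. - (A $ i)) ` J"
    by (auto simp: subset_image_inj)
  obtain l where l: "w = (\<Sum>v\<in>U. l v *\<^sub>R v)" "\<And>v. v \<in> U \<Longrightarrow> 0 \<le> l v"
    using U(3) by (rule finite_coneE) blast
  have "J \<in> surjective_sets A" using independent_rows_surjective J U by blast
  moreover have "J \<noteq> {}" using w(1) l(1) J(3) by auto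
  moreover have "least_norm J c = N z"
  proof (rule least_norm_eq)
    show "\<forall>i\<in>J. (A *v z) $ i \<le> c $ i" using J(1) by (auto simp: I_def)
    fix x assume x: "\<forall>i\<in>J. (A *v x) $ i \<le> c $ i"
    \<comment> \<open>On \<open>J\<close> the point \<open>x\<close> satisfies the constraints that
      \<open>z\<close> meets with equality, so every term is nonnegative.\<close>
    have "w \<bullet> (x - z) = (\<Sum>v\<in>U. l v * (v \<bullet> (x - z)))" by (simp add: l inner_sum_left)
    also have "\<dots> \<ge> 0"
    proof (rule sum_nonneg)
      fix v assume v: "v \<in> U"
      then obtain i where i: "i \<in> J" "v = - (A $ i)" using J(3) by blast
      have "(A *v x) $ i \<le> (A *v z) $ i" using x i J(1) by (auto simp: I_def)
      then have "0 \<le> v \<bullet> (x - z)" by (simp add: i matrix_vector_mul_component inner_diff_right)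
      then show "0 \<le> l v * (v \<bullet> (x - z))" using l(2)[OF v] by simp
    qed
    finally have "w \<bullet> z \<le> w \<bullet> x" by (simp add: inner_diff_right)
    then show "N z \<le> N x" using w(3)[rule_format, of x] by linarith
  qed
  ultimately show ?thesis using that by blast
qed

section \<open>The distance bound and its tightness\<close>

lemma least_norm_mono:
  assumes J: "J \<in> surjective_sets A" and le: "y \<le> c"
  shows "least_norm J c \<le> least_norm J y"
proof -
  obtain x where x: "\<forall>i\<in>J. (A *v x) $ i \<le> y $ i" "least_norm J y = N x"
    by (rule least_norm_attained[OF J, of y]) blast
  have "least_norm J c \<le> N x"
    by (rule least_norm_le[OF J]) (use x(1) le in \<open>auto simp: less_eq_vec_def intro: order_trans\<close>)
  then show ?thesis by (simp add: x(2))
qed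

lemma dist_to_polyhedron_le:
  assumes "polyhedron_of A b \<noteq> {}"
  shows "dist_to N u (polyhedron_of A b) \<le> hoffman N M A * dist_to M (b - A *v u) orthant"
proof -
  define c where "c = b - A *v u"
  have shift: "u + x \<in> polyhedron_of A b \<longleftrightarrow> x \<in> polyhedron_of A c" for x
    by (simp add: polyhedron_of_def c_def matrix_vector_right_distrib le_diff_eq add.commute)
  obtain x0 where "x0 \<in> polyhedron_of A b" using assms by blast
  then have "polyhedron_of A c \<noteq> {}" using shift[of "x0 - u"] by auto
  then obtain z where z: "z \<in> polyhedron_of A c" "\<And>x. x \<in> polyhedron_of A c \<Longrightarrow> N z \<le> N x"
    by (rule dom.attains_min[OF closed_polyhedron_of]) blast
  have "(orthant :: (real^'m) set) \<noteq> {}" by (auto simp: orthant_def)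
  then obtain s where s: "s \<in> orthant" "dist_to M c orthant = M (c - s)"
    by (rule cod.dist_to_attained[OF closed_orthant]) blast
  have "dist_to N u (polyhedron_of A b) \<le> N (u - (u + z))"
    by (rule dom.dist_to_le[OF closed_polyhedron_of]) (simp add: shift z(1))
  also have "\<dots> = N z" by (simp add: dom.minus)
  also have "N z \<le> hoffman N M A * M (c - s)"
  proof (cases "z = 0")
    case True
    then show ?thesis by (simp add: dom.zero hoffman_nonneg cod.nonneg)
  next
    case False
    obtain J where J: "J \<in> surjective_sets A" "J \<noteq> {}" "least_norm J c = N z"
      by (rule least_norm_point_surjective_set[OF z(1) False z(2)]) blast
    \<comment> \<open>Subtracting the nonnegative \<open>s\<close> tightens the system, so the least
      norm can only grow.\<close>
    have "N z \<le> least_norm J (c - s)"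
      using least_norm_mono[OF J(1), of "c - s" c] s(1) J(3) by (simp add: orthant_def)
    also have "\<dots> \<le> hoffman_sub N M A J * M (c - s)" by (rule least_norm_le_hoffman_sub[OF J(1,2)])
    also have "\<dots> \<le> hoffman N M A * M (c - s)"
      by (intro mult_right_mono hoffman_sub_le_hoffman J cod.nonneg)
    finally show ?thesis .
  qed
  finally show ?thesis using s(2) by (simp add: c_def)
qed

text \<open>The sum \<open>c + pos_part (- c)\<close> is the positive part of \<open>c\<close>,
  hence a competitor in the orthant.\<close>

lemma dist_to_orthant_le: "dist_to M c orthant \<le> M (pos_part (- c))"
proof -
  have "c + pos_part (- c) \<in> orthant" by (auto simp: orthant_def pos_part_def less_eq_vec_def)
  then have "dist_to M c orthant \<le> M (c - (c + pos_part (- c)))"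
    by (rule cod.dist_to_le[OF closed_orthant])
  then show ?thesis by (simp add: cod.minus)
qed

lemma hoffman_tight:
  assumes pos: "hoffman N M A > 0"
  obtains b where "polyhedron_of A b \<noteq> {}"
    "dist_to N 0 (polyhedron_of A b) = hoffman N M A * dist_to M b orthant"
    "dist_to N 0 (polyhedron_of A b) > 0"
proof -
  obtain J where J: "J \<in> surjective_sets A" "hoffman N M A = hoffman_sub N M A J"
    by (rule hoffman_attained)
  have "J \<noteq> {}" using J(2) pos by (auto simp: hoffman_sub_def)
  then obtain y where y: "M y \<le> 1" "hoffman N M A = least_norm J y"
    by (metis hoffman_sub_attained[OF J(1)] J(2))
  obtain x where x: "\<forall>i\<in>J. (A *v x) $ i \<le> y $ i" "least_norm J y = N x"
    "\<And>x'. \<forall>i\<in>J. (A *v x') $ i \<le> y $ i \<Longrightarrow> N x \<le> N x'"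
    by (rule least_norm_attained[OF J(1), of y]) blast
  \<comment> \<open>Off \<open>J\<close>, the maximum with \<open>A *v x\<close> keeps
    \<open>x\<close> feasible, and the maximum with \<open>y\<close> ensures
    \<open>y \<le> b\<close>.\<close>
  define b where "b = (\<chi> i. if i \<in> J then y $ i else max (y $ i) ((A *v x) $ i))"
  have xP: "x \<in> polyhedron_of A b" using x(1) by (auto simp: polyhedron_of_eq b_def)
  then have ne: "polyhedron_of A b \<noteq> {}" by blast
  obtain z where z: "z \<in> polyhedron_of A b" "dist_to N 0 (polyhedron_of A b) = N (0 - z)"
    by (rule dom.dist_to_attained[OF closed_polyhedron_of ne])
  have "(A *v z) $ i \<le> y $ i" if "i \<in> J" for i
    using z(1) that by (auto simp: polyhedron_of_eq b_def dest: spec[of _ i])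
  then have ge: "hoffman N M A \<le> dist_to N 0 (polyhedron_of A b)"
    using x(3)[of z] by (simp add: z(2) y(2) x(2) dom.minus)
  \<comment> \<open>The competitor \<open>b - y\<close> bounds the distance of \<open>b\<close> to
    the orthant by \<open>M y\<close>, hence by \<open>1\<close>.\<close>
  have "b - y \<in> orthant" by (auto simp: orthant_def less_eq_vec_def b_def)
  then have "dist_to M b orthant \<le> M (b - (b - y))" by (rule cod.dist_to_le[OF closed_orthant])
  then have "dist_to M b orthant \<le> 1" using y(1) by simp
  then have "hoffman N M A * dist_to M b orthant \<le> hoffman N M A"
    using pos by (simp add: mult_left_le)
  moreover have "dist_to N 0 (polyhedron_of A b) \<le> hoffman N M A * dist_to M b orthant"
    using dist_to_polyhedron_le[OF ne, of 0] by simp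
  \<comment> \<open>The inequalities form a chain that starts and ends at
    \<open>hoffman N M A\<close>, so all are equalities.\<close>
  ultimately show ?thesis using that[OF ne] ge pos by linarith
qed

end

theorem proposition1:
  fixes A :: "real^'n^'m"
    and N :: "real^'n \<Rightarrow> real"
    and M :: "real^'m \<Rightarrow> real"
  assumes "is_norm N" and "is_norm M"
  shows
    "(\<forall>b \<in> range (\<lambda>x. A *v x) + orthant. \<forall>u.
        dist_to N u (polyhedron_of A b) \<le> hoffman N M A * dist_to M (b - A *v u) orthant \<and>
        hoffman N M A * dist_to M (b - A *v u) orthant \<le> hoffman N M A * M (pos_part (A *v u - b)))
     \<and>
     (hoffman N M A > 0 \<longrightarrow>
       (\<exists>b \<in> range (\<lambda>x. A *v x) + orthant. \<exists>u.
          dist_to N u (polyhedron_of A b) = hoffman N M A * dist_to M (b - A *v u) orthant \<and>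
          hoffman N M A * dist_to M (b - A *v u) orthant > 0))"
proof -
  interpret norm_pair N M A
    using assms by (intro norm_pair.intro norm_fun.intro)
  show ?thesis
  proof (intro conjI ballI allI impI)
    fix b u assume "b \<in> range (\<lambda>x. A *v x) + orthant"
    then show "dist_to N u (polyhedron_of A b) \<le> hoffman N M A * dist_to M (b - A *v u) orthant"
      by (intro dist_to_polyhedron_le) (simp add: range_plus_orthant_iff)
    show "hoffman N M A * dist_to M (b - A *v u) orthant \<le> hoffman N M A * M (pos_part (A *v u - b))"
      using dist_to_orthant_le[of "b - A *v u"] hoffman_nonneg by (simp add: mult_left_mono)
  next
    assume "hoffman N M A > 0"
    then obtain b where "polyhedron_of A b \<noteq> {}"
      "dist_to N 0 (polyhedron_of A b) = hoffman N M A * dist_to M b orthant"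
      "dist_to N 0 (polyhedron_of A b) > 0"
      by (rule hoffman_tight)
    then show "\<exists>b \<in> range (\<lambda>x. A *v x) + orthant. \<exists>u.
        dist_to N u (polyhedron_of A b) = hoffman N M A * dist_to M (b - A *v u) orthant \<and>
        hoffman N M A * dist_to M (b - A *v u) orthant > 0"
      by (intro bexI[of _ b] exI[of _ 0]) (auto simp: range_plus_orthant_iff)
  qed
qed

end
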